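(* Let $n\ge3$, let $a_1,a_2>0$ and let $s_1\ne s_2$ be integers in $\{0,\dots,n-1\}$. Then it is not the case that $f_4(v_{a_1,s_1})=f_4(v_{a_2,s_2})=f_6(v_{a_1,s_1})=f_6(v_{a_2,s_2})=0$.
   Context: $v_{a,s} = (a^2+s)^{-1/2}(a,\underbrace{1,\dots,1}_{s},0,\dots,0)\in\mathbb{R}^n$. For exponents $\lambda_1,\dots,\lambda_r$, $m_{(\lambda_1,\dots,\lambda_r)}(x)$ denotes the sum of all distinct monomials $x_{i_1}^{\lambda_1}\cdots x_{i_r}^{\lambda_r}$ with $i_1,\dots,i_r$ distinct in $\{1,\dots,n\}$ (each distinct monomial counted once). Define $f_4 = m_{(4)} - \frac{6}{n-1}m_{(2,2)}$ and $f_6 = m_{(6)} - \frac{15}{n-1}m_{(2,4)} + \frac{180}{(n-1)(n-2)}m_{(2,2,2)}$. *)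

theory Defs
  imports Complex_Main
begin

text \<open>Vectors of \<open>\<real>\<^sup>n\<close> are functions \<open>x :: nat \<Rightarrow> real\<close> of which only the coordinates
  \<open>x 1, \<dots>, x n\<close> are used.\<close>

text \<open>A monomial in \<open>x\<^sub>1, \<dots>, x\<^sub>n\<close> is represented by its exponent vector. The set below contains
  the exponent vectors of the monomials \<open>x\<^bsub>i\<^sub>1\<^esub> ^ \<lambda>\<^sub>1 * \<dots> * x\<^bsub>i\<^sub>r\<^esub> ^ \<lambda>\<^sub>r\<close> with distinct
  indices \<open>i\<^sub>1, \<dots>, i\<^sub>r\<close>; since it is a set, index choices that give the same monomial
  are not counted twice.\<close>

definition monomial_exponents :: "nat \<Rightarrow> nat list \<Rightarrow> (nat \<Rightarrow> nat) set" where
  "monomial_exponents n ls =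
     {\<alpha>. \<exists>is. length is = length ls \<and> distinct is \<and> set is \<subseteq> {1..n} \<and>
          \<alpha> = (\<lambda>j. \<Sum>k<length ls. if is ! k = j then ls ! k else 0)}"

definition monomial_sym :: "nat \<Rightarrow> nat list \<Rightarrow> (nat \<Rightarrow> real) \<Rightarrow> real" where
  "monomial_sym n ls x = (\<Sum>\<alpha>\<in>monomial_exponents n ls. \<Prod>i=1..n. x i ^ \<alpha> i)"

lemma finite_monomial_exponents: "finite (monomial_exponents n ls)"
proof -
  have "monomial_exponents n ls \<subseteq>
      (\<lambda>is j. \<Sum>k<length ls. if is ! k = j then ls ! k else 0) `
        {is. set is \<subseteq> {1..n} \<and> length is = length ls}"
    unfolding monomial_exponents_def by blast
  then show ?thesis
    by (rule finite_subset) (intro finite_imageI finite_lists_length_eq finite_atLeastAtMost)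
qed

definition f4 :: "nat \<Rightarrow> (nat \<Rightarrow> real) \<Rightarrow> real" where
  "f4 n x = monomial_sym n [4] x - 6 / (real n - 1) * monomial_sym n [2, 2] x"

definition f6 :: "nat \<Rightarrow> (nat \<Rightarrow> real) \<Rightarrow> real" where
  "f6 n x = monomial_sym n [6] x - 15 / (real n - 1) * monomial_sym n [2, 4] x
     + 180 / ((real n - 1) * (real n - 2)) * monomial_sym n [2, 2, 2] x"

text \<open>For \<open>s \<le> n - 1\<close> this is supported on the coordinates \<open>1, \<dots>, n\<close>, so the dimension
  \<open>n\<close> is not needed as an argument.\<close>

definition v :: "real \<Rightarrow> nat \<Rightarrow> nat \<Rightarrow> real" where
  "v a s = (\<lambda>i. (a\<^sup>2 + real s) powr (- 1 / 2) *
     (if i = 1 then a else if 2 \<le> i \<and> i \<le> s + 1 then 1 else 0))"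

end

theory Submission
  imports Defs
begin

text \<open>Put \<open>N = n - 1\<close> and \<open>t = a\<^sup>2\<close>. By Newton's identities and \<open>\<Sum>\<^sub>i v\<^sub>i\<^sup>k = c\<^sup>k (a\<^sup>k + s)\<close>, the equations
  \<open>f\<^sub>4 = f\<^sub>6 = 0\<close> at \<open>v\<^sub>a\<^sub>,\<^sub>s\<close> are a quadratic and a cubic equation in \<open>t\<close>. Reducing the cubic
  modulo the quadratic leaves a linear equation, so eliminating \<open>t\<close> gives a quartic equation
  \<open>q(s) = 0\<close> with coefficients in \<open>\<int>[N]\<close>. Since \<open>q(s) / s\<^sup>4\<close> is strictly decreasing for
  \<open>s \<ge> 1\<close>, at most one such \<open>s\<close> can occur for a given \<open>n\<close>; \<open>s = 0\<close> is excluded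
  because then \<open>f\<^sub>4 = 1\<close>.\<close>

section \<open>Monomial symmetric sums for the exponent shapes that occur\<close>

text \<open>Injectivity of \<open>g\<close> is what makes each distinct monomial count once; each
  exponent shape below needs its own index set \<open>B\<close>.\<close>

lemma monomial_sym_eq_sum_image:
  assumes "monomial_exponents n ls = g ` B" and "inj_on g B"
  shows "monomial_sym n ls x = (\<Sum>b\<in>B. \<Prod>i=1..n. x i ^ g b i)"
  unfolding monomial_sym_def assms(1) by (simp add: sum.reindex[OF assms(2)])

lemma monomial_sym_single:
  assumes "k > 0"
  shows "monomial_sym n [k] x = (\<Sum>i=1..n. x i ^ k)"
proof -
  let ?g = "\<lambda>i j. if i = j then k else (0::nat)"
  have "monomial_exponents n [k] = ?g ` {1..n}"
  proof (intro equalityI subsetI)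
    fix \<alpha> assume "\<alpha> \<in> monomial_exponents n [k]"
    then obtain i where "i \<in> {1..n}"
      and \<alpha>: "\<alpha> = (\<lambda>j. \<Sum>m<length [k]. if [i] ! m = j then [k] ! m else 0)"
      by (auto simp: monomial_exponents_def length_Suc_conv)
    moreover have "\<alpha> = ?g i" by (auto simp: \<alpha>)
    ultimately show "\<alpha> \<in> ?g ` {1..n}" by blast
  next
    fix \<alpha> assume "\<alpha> \<in> ?g ` {1..n}"
    then obtain i where i: "i \<in> {1..n}" "\<alpha> = ?g i" by auto
    then have "length [i] = length [k] \<and> distinct [i] \<and> set [i] \<subseteq> {1..n} \<and>
       \<alpha> = (\<lambda>j. \<Sum>m<length [k]. if [i] ! m = j then [k] ! m else 0)"
      by auto
    then show "\<alpha> \<in> monomial_exponents n [k]" unfolding monomial_exponents_def by blast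
  qed
  \<comment> \<open>For \<open>k = 0\<close> all these exponent vectors would coincide.\<close>
  moreover have "inj_on ?g {1..n}"
    using assms by (intro inj_onI) (metis less_irrefl)
  ultimately have "monomial_sym n [k] x = (\<Sum>i=1..n. \<Prod>j=1..n. x j ^ ?g i j)"
    by (rule monomial_sym_eq_sum_image)
  also have "\<dots> = (\<Sum>i=1..n. \<Prod>j=1..n. if i = j then x j ^ k else 1)"
    by (intro sum.cong prod.cong) auto
  also have "\<dots> = (\<Sum>i=1..n. x i ^ k)"
    by (intro sum.cong) (auto simp: prod.delta)
  finally show ?thesis .
qed

text \<open>As the exponents differ, an exponent vector determines the ordered pair of indices. The
  sum therefore runs over off-diagonal pairs, that is, the full product minus its diagonal.\<close>

lemma monomial_sym_pair:
  assumes "k > 0" "l > 0" "k \<noteq> l"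
  shows "monomial_sym n [k, l] x =
    (\<Sum>i=1..n. x i ^ k) * (\<Sum>i=1..n. x i ^ l) - (\<Sum>i=1..n. x i ^ (k + l))"
proof -
  let ?g = "\<lambda>(p, q) j. if p = j then k else if q = j then l else (0::nat)"
  let ?D = "{1..n} \<times> {1..n}"
  let ?B = "?D - (\<lambda>i. (i, i)) ` {1..n}"
  have "monomial_exponents n [k, l] = ?g ` ?B"
  proof (intro equalityI subsetI)
    fix \<alpha> assume "\<alpha> \<in> monomial_exponents n [k, l]"
    then obtain p q where pq: "p \<in> {1..n}" "q \<in> {1..n}" "p \<noteq> q"
      and \<alpha>: "\<alpha> = (\<lambda>j. \<Sum>m<length [k, l]. if [p, q] ! m = j then [k, l] ! m else 0)"
      by (auto simp: monomial_exponents_def length_Suc_conv)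
    have "\<alpha> = ?g (p, q)" using pq by (auto simp: \<alpha> fun_eq_iff)
    moreover have "(p, q) \<in> ?B" using pq by auto
    ultimately show "\<alpha> \<in> ?g ` ?B" by blast
  next
    fix \<alpha> assume "\<alpha> \<in> ?g ` ?B"
    then obtain p q where pq: "(p, q) \<in> ?B" "\<alpha> = ?g (p, q)" by blast
    then have "p \<in> {1..n}" "q \<in> {1..n}" "p \<noteq> q" by auto
    with pq(2)
    have "length [p, q] = length [k, l] \<and> distinct [p, q] \<and> set [p, q] \<subseteq> {1..n} \<and>
       \<alpha> = (\<lambda>j. \<Sum>m<length [k, l]. if [p, q] ! m = j then [k, l] ! m else 0)"
      by auto
    then show "\<alpha> \<in> monomial_exponents n [k, l]" unfolding monomial_exponents_def by blast
  qed
  moreover have "inj_on ?g ?B"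
  proof (rule inj_onI, clarify)
    fix p q p' q'
    assume ne: "(p, q) \<notin> (\<lambda>i. (i, i)) ` {1..n}" "(p', q') \<notin> (\<lambda>i. (i, i)) ` {1..n}"
      and mem: "p \<in> {1..n}" "p' \<in> {1..n}"
      and eq: "(\<lambda>j. if p = j then k else if q = j then l else 0) =
         (\<lambda>j. if p' = j then k else if q' = j then l else 0)"
    have "p \<noteq> q" "p' \<noteq> q'" using ne mem by auto
    \<comment> \<open>At \<open>p\<close> the left vector has value \<open>k\<close>, which is
      neither \<open>l\<close> nor 0, so only \<open>p'\<close> can produce it on the right.\<close>
    moreover have "p = p'"
      using fun_cong[OF eq, of p] assms by (simp split: if_splits)
    moreover have "q = q'"
      using fun_cong[OF eq, of q] assms calculation by (simp split: if_splits)
    ultimately show "p = p' \<and> q = q'" by simp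
  qed
  ultimately have "monomial_sym n [k, l] x = (\<Sum>b\<in>?B. \<Prod>j=1..n. x j ^ ?g b j)"
    by (rule monomial_sym_eq_sum_image)
  also have "\<dots> = (\<Sum>(p, q)\<in>?B. x p ^ k * x q ^ l)"
  proof (rule sum.cong[OF refl], clarify)
    fix p q assume pq: "p \<in> {1..n}" "q \<in> {1..n}" "(p, q) \<notin> (\<lambda>i. (i, i)) ` {1..n}"
    then have "p \<noteq> q" by auto
    then have "(\<Prod>j=1..n. x j ^ (if p = j then k else if q = j then l else 0)) =
      (\<Prod>j=1..n. (if p = j then x j ^ k else 1) * (if q = j then x j ^ l else 1))"
      by (intro prod.cong) auto
    also have "\<dots> = x p ^ k * x q ^ l"
      using pq by (simp add: prod.distrib)
    finally show "(\<Prod>j=1..n. x j ^ (if p = j then k else if q = j then l else 0)) =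
      x p ^ k * x q ^ l" .
  qed
  also have "\<dots> = (\<Sum>(p, q)\<in>?D. x p ^ k * x q ^ l)
      - (\<Sum>(p, q)\<in>(\<lambda>i. (i, i)) ` {1..n}. x p ^ k * x q ^ l)"
    by (rule sum_diff) auto
  also have "(\<Sum>(p, q)\<in>(\<lambda>i. (i, i)) ` {1..n}. x p ^ k * x q ^ l) = (\<Sum>i=1..n. x i ^ (k + l))"
    by (subst sum.reindex) (auto simp: inj_on_def power_add)
  also have "(\<Sum>(p, q)\<in>?D. x p ^ k * x q ^ l) = (\<Sum>i=1..n. x i ^ k) * (\<Sum>i=1..n. x i ^ l)"
    by (simp add: sum_product sum.cartesian_product)
  finally show ?thesis .
qed

text \<open>With equal exponents, permuting the indices gives the same monomial, so an exponent
  vector remembers only its support. Hence the sum is over \<open>r\<close>-subsets, without a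
  factor \<open>r!\<close>.\<close>

lemma monomial_sym_replicate:
  assumes "c > 0"
  shows "monomial_sym n (replicate r c) x =
    (\<Sum>A | A \<subseteq> {1..n} \<and> card A = r. \<Prod>i\<in>A. x i ^ c)"
proof -
  let ?g = "\<lambda>A j. if j \<in> A then c else (0::nat)"
  let ?B = "{A. A \<subseteq> {1..n} \<and> card A = r}"
  have exps: "(\<lambda>j. \<Sum>k<length (replicate r c). if is ! k = j then replicate r c ! k else 0) =
      ?g (set is)" if "length is = r" "distinct is" for "is" :: "nat list"
  proof
    fix j
    have "(\<Sum>k<length (replicate r c). if is ! k = j then replicate r c ! k else 0) =
        (\<Sum>k<r. if is ! k = j then c else 0)"
      by (intro sum.cong) auto
    also have "\<dots> = ?g (set is) j"
    proof (cases "j \<in> set is")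
      case True
      then obtain k0 where "k0 < length is" and j: "is ! k0 = j"
        unfolding in_set_conv_nth by blast
      then have k0: "k0 < r" using that by simp
      \<comment> \<open>Distinctness of the list leaves \<open>k0\<close> as the only position
        holding \<open>j\<close>.\<close>
      have "(\<Sum>k<r. if is ! k = j then c else 0) = (\<Sum>k<r. if k = k0 then c else 0)"
        using that k0 j by (intro sum.cong) (auto simp: nth_eq_iff_index_eq)
      then show ?thesis using True k0 by simp
    next
      case False
      then show ?thesis using that by (auto intro!: sum.neutral)
    qed
    finally show "(\<Sum>k<length (replicate r c). if is ! k = j then replicate r c ! k else 0) =
      ?g (set is) j" .
  qed
  have "monomial_exponents n (replicate r c) = ?g ` ?B"
  proof (intro equalityI subsetI)
    fix \<alpha> assume "\<alpha> \<in> monomial_exponents n (replicate r c)"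
    then obtain "is" where "length is = r" "distinct is" "set is \<subseteq> {1..n}"
      "\<alpha> = (\<lambda>j. \<Sum>k<length (replicate r c). if is ! k = j then replicate r c ! k else 0)"
      unfolding monomial_exponents_def by auto
    then have "\<alpha> = ?g (set is)" "set is \<in> ?B"
      using exps by (auto simp: distinct_card)
    then show "\<alpha> \<in> ?g ` ?B" by blast
  next
    fix \<alpha> assume "\<alpha> \<in> ?g ` ?B"
    then obtain A where A: "A \<subseteq> {1..n}" "card A = r" "\<alpha> = ?g A" by auto
    then have "finite A" using finite_subset by blast
    then obtain "is" where "set is = A" "distinct is"
      using finite_distinct_list by blast
    with A have "length is = length (replicate r c) \<and> distinct is \<and> set is \<subseteq> {1..n} \<and>
       \<alpha> = (\<lambda>j. \<Sum>m<length (replicate r c). if is ! m = j then replicate r c ! m else 0)"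
      using exps[of "is"] by (auto simp: distinct_card[symmetric])
    then show "\<alpha> \<in> monomial_exponents n (replicate r c)" unfolding monomial_exponents_def by blast
  qed
  moreover have "inj_on ?g ?B"
  proof (intro inj_onI set_eqI)
    fix A B j assume "?g A = ?g B"
    from fun_cong[OF this, of j] show "j \<in> A \<longleftrightarrow> j \<in> B"
      using assms by (auto split: if_splits)
  qed
  ultimately have "monomial_sym n (replicate r c) x = (\<Sum>A\<in>?B. \<Prod>j=1..n. x j ^ ?g A j)"
    by (rule monomial_sym_eq_sum_image)
  also have "\<dots> = (\<Sum>A\<in>?B. \<Prod>i\<in>A. x i ^ c)"
  proof (rule sum.cong[OF refl])
    fix A assume "A \<in> ?B"
    then have A: "{1..n} \<inter> A = A" by auto
    have "(\<Prod>j=1..n. x j ^ ?g A j) = (\<Prod>j=1..n. if j \<in> A then x j ^ c else 1)"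
      by (intro prod.cong) auto
    also have "\<dots> = (\<Prod>i\<in>A. x i ^ c)"
      using prod.inter_restrict[of "{1..n}" "\<lambda>j. x j ^ c" A] A by simp
    finally show "(\<Prod>j=1..n. x j ^ ?g A j) = (\<Prod>i\<in>A. x i ^ c)" .
  qed
  finally show ?thesis .
qed

section \<open>Elementary symmetric polynomials and Newton's identities\<close>

text \<open>The elementary symmetric polynomial of degree \<open>r\<close>, over an arbitrary index
  set so that induction on \<open>I\<close> is possible.\<close>

definition esym :: "nat \<Rightarrow> 'a set \<Rightarrow> ('a \<Rightarrow> real) \<Rightarrow> real" where
  "esym r I y = (\<Sum>A | A \<subseteq> I \<and> card A = r. \<Prod>i\<in>A. y i)"

lemma esym_0: "finite I \<Longrightarrow> esym 0 I y = 1"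
proof -
  assume "finite I"
  then have "{A. A \<subseteq> I \<and> card A = 0} = {{}}"
    by (auto dest: finite_subset)
  then show ?thesis by (simp add: esym_def)
qed

lemma esym_Suc_empty: "esym (Suc r) {} y = 0"
proof -
  have "{A. A \<subseteq> {} \<and> card A = Suc r} = {}" by auto
  then show ?thesis unfolding esym_def by simp
qed

text \<open>Pascal-type recursion: subsets of \<open>insert a I\<close> are split by whether they
  contain \<open>a\<close>.\<close>

lemma esym_Suc_insert:
  assumes "finite I" "a \<notin> I"
  shows "esym (Suc r) (insert a I) y = esym (Suc r) I y + y a * esym r I y"
proof -
  let ?S = "\<lambda>r. {A. A \<subseteq> I \<and> card A = r}"
  have split: "{A. A \<subseteq> insert a I \<and> card A = Suc r} = ?S (Suc r) \<union> insert a ` ?S r"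
  proof (intro equalityI subsetI)
    fix A assume A: "A \<in> {A. A \<subseteq> insert a I \<and> card A = Suc r}"
    show "A \<in> ?S (Suc r) \<union> insert a ` ?S r"
    proof (cases "a \<in> A")
      case True
      have "finite A" using A assms finite_subset[of A "insert a I"] by auto
      then have "A - {a} \<in> ?S r" "A = insert a (A - {a})" using A True by auto
      then show ?thesis by blast
    qed (use A in auto)
  next
    fix A assume "A \<in> ?S (Suc r) \<union> insert a ` ?S r"
    moreover have "card (insert a C) = Suc (card C)" if "C \<subseteq> I" for C
      using that assms finite_subset by (metis card_insert_disjoint subsetD)
    ultimately show "A \<in> {A. A \<subseteq> insert a I \<and> card A = Suc r}" by auto
  qed
  have inj: "inj_on (insert a) (?S r)"
    using assms(2) by (intro inj_onI) (auto simp: insert_eq_iff)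
  have "esym (Suc r) (insert a I) y =
      esym (Suc r) I y + (\<Sum>A\<in>insert a ` ?S r. \<Prod>i\<in>A. y i)"
    unfolding esym_def split using assms by (intro sum.union_disjoint) auto
  also have "(\<Sum>A\<in>insert a ` ?S r. \<Prod>i\<in>A. y i) = (\<Sum>A\<in>?S r. \<Prod>i\<in>insert a A. y i)"
    by (simp add: sum.reindex[OF inj])
  also have "\<dots> = (\<Sum>A\<in>?S r. y a * (\<Prod>i\<in>A. y i))"
  proof (rule sum.cong[OF refl])
    fix A assume "A \<in> ?S r"
    then have "finite A" "a \<notin> A" using assms finite_subset by auto
    then show "(\<Prod>i\<in>insert a A. y i) = y a * (\<Prod>i\<in>A. y i)" by simp
  qed
  also have "\<dots> = y a * esym r I y"
    by (simp add: esym_def sum_distrib_left)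
  finally show ?thesis .
qed

text \<open>Newton's identities in degrees 2 and 3. Degrees 1 to 3 go through one induction, since
  the recursion for each degree uses the degree below.\<close>

lemma esym_power_sums:
  assumes "finite I"
  shows esym_2: "2 * esym 2 I y = (\<Sum>i\<in>I. y i)\<^sup>2 - (\<Sum>i\<in>I. y i ^ 2)"
    and esym_3: "6 * esym 3 I y =
      (\<Sum>i\<in>I. y i) ^ 3 - 3 * (\<Sum>i\<in>I. y i) * (\<Sum>i\<in>I. y i ^ 2) + 2 * (\<Sum>i\<in>I. y i ^ 3)"
proof -
  have "esym 1 I y = (\<Sum>i\<in>I. y i) \<and>
    2 * esym 2 I y = (\<Sum>i\<in>I. y i)\<^sup>2 - (\<Sum>i\<in>I. y i ^ 2) \<and>
    6 * esym 3 I y =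
      (\<Sum>i\<in>I. y i) ^ 3 - 3 * (\<Sum>i\<in>I. y i) * (\<Sum>i\<in>I. y i ^ 2) + 2 * (\<Sum>i\<in>I. y i ^ 3)"
    using assms
  proof (induction I rule: finite_induct)
    case empty
    then show ?case
      by (simp add: numeral_eq_Suc esym_Suc_empty)
  next
    case (insert a I)
    have 1: "esym 1 (insert a I) y = esym 1 I y + y a"
      using esym_Suc_insert[OF insert(1,2), of 0] esym_0[OF insert(1)] by simp
    have 2: "esym 2 (insert a I) y = esym 2 I y + y a * esym 1 I y"
      using esym_Suc_insert[OF insert(1,2), of 1] by (simp add: numeral_eq_Suc)
    have 3: "esym 3 (insert a I) y = esym 3 I y + y a * esym 2 I y"
      using esym_Suc_insert[OF insert(1,2), of 2] by (simp add: numeral_eq_Suc)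
    have "6 * esym 3 (insert a I) y = 6 * esym 3 I y + 3 * y a * (2 * esym 2 I y)"
      using 3 by simp
    then show ?case
      using insert 1 2 by (simp add: power2_eq_square power3_eq_cube algebra_simps)
  qed
  then show "2 * esym 2 I y = (\<Sum>i\<in>I. y i)\<^sup>2 - (\<Sum>i\<in>I. y i ^ 2)"
    "6 * esym 3 I y =
      (\<Sum>i\<in>I. y i) ^ 3 - 3 * (\<Sum>i\<in>I. y i) * (\<Sum>i\<in>I. y i ^ 2) + 2 * (\<Sum>i\<in>I. y i ^ 3)"
    by blast+
qed

section \<open>Power sum forms of \<open>f4\<close> and \<open>f6\<close>, and their values at
  \<open>v a s\<close>\<close>

lemma f4_power_sums:
  fixes x :: "nat \<Rightarrow> real" and n :: nat
  defines "p \<equiv> \<lambda>k. \<Sum>i=1..n. x i ^ k"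
  shows "f4 n x = p 4 - 3 / (real n - 1) * (p 2 ^ 2 - p 4)"
proof -
  have "replicate 2 2 = [2, 2::nat]" by (simp add: numeral_eq_Suc)
  then have "2 * monomial_sym n [2, 2] x = p 2 ^ 2 - p 4"
    using monomial_sym_replicate[of 2 n 2 x] esym_2[of "{1..n}" "\<lambda>i. x i ^ 2"]
    by (simp add: esym_def p_def flip: power_mult)
  then have "monomial_sym n [2, 2] x = (p 2 ^ 2 - p 4) / 2"
    by simp
  then show ?thesis
    by (simp add: f4_def monomial_sym_single p_def)
qed

lemma f6_power_sums:
  fixes x :: "nat \<Rightarrow> real" and n :: nat
  defines "p \<equiv> \<lambda>k. \<Sum>i=1..n. x i ^ k"
  shows "f6 n x = p 6 - 15 / (real n - 1) * (p 2 * p 4 - p 6)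
    + 30 / ((real n - 1) * (real n - 2)) * (p 2 ^ 3 - 3 * p 2 * p 4 + 2 * p 6)"
proof -
  have "replicate 3 2 = [2, 2, 2::nat]" by (simp add: numeral_eq_Suc)
  then have "6 * monomial_sym n [2, 2, 2] x = p 2 ^ 3 - 3 * p 2 * p 4 + 2 * p 6"
    using monomial_sym_replicate[of 2 n 3 x] esym_3[of "{1..n}" "\<lambda>i. x i ^ 2"]
    by (simp add: esym_def p_def flip: power_mult)
  then have "monomial_sym n [2, 2, 2] x = (p 2 ^ 3 - 3 * p 2 * p 4 + 2 * p 6) / 6"
    by simp
  then show ?thesis
    by (simp add: f6_def monomial_sym_single monomial_sym_pair p_def)
qed

text \<open>The bound \<open>s < n\<close> keeps the block of ones at positions 2 to
  \<open>s + 1\<close> inside the range, and \<open>k > 0\<close> makes the zero coordinates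
  contribute nothing.\<close>

lemma v_power_sum:
  assumes "k > 0" "s < n"
  shows "(\<Sum>i=1..n. v a s i ^ k) = ((a\<^sup>2 + real s) powr (- 1 / 2)) ^ k * (a ^ k + real s)"
proof -
  let ?c = "(a\<^sup>2 + real s) powr (- 1 / 2)"
  have "(\<Sum>i=1..n. v a s i ^ k) =
      (\<Sum>i=1..n. (if i = 1 then ?c ^ k * a ^ k else 0) + (if i \<in> {2..s+1} then ?c ^ k else 0))"
    using assms(1) by (intro sum.cong) (auto simp: v_def power_mult_distrib)
  also have "\<dots> = ?c ^ k * a ^ k + (\<Sum>i=1..n. if i \<in> {2..s+1} then ?c ^ k else 0)"
    using assms(2) by (subst sum.distrib) simp
  also have "(\<Sum>i=1..n. if i \<in> {2..s+1} then ?c ^ k else 0) =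
      (\<Sum>i\<in>{1..n} \<inter> {2..s+1}. ?c ^ k)"
    by (rule sum.inter_restrict[symmetric]) simp
  also have "{1..n} \<inter> {2..s+1} = {2..s+1}" using assms(2) by auto
  also have "?c ^ k * a ^ k + (\<Sum>i\<in>{2..s+1}. ?c ^ k) = ?c ^ k * (a ^ k + real s)"
    by (simp add: distrib_left)
  finally show ?thesis .
qed

text \<open>\<open>f4\<close> is homogeneous of degree 4, so the normalising factor comes out as the
  nonzero \<open>c ^ 4\<close>; then the denominator is cleared.\<close>

lemma f4_v_eq_0_iff:
  assumes "n \<ge> 3" "s < n" "a > 0"
  shows "f4 n (v a s) = 0 \<longleftrightarrow>
    (real n - 1) * (a ^ 4 + real s) - 3 * ((a\<^sup>2 + real s)\<^sup>2 - (a ^ 4 + real s)) = 0"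
    (is "_ \<longleftrightarrow> ?F = 0")
proof -
  define c where "c = (a\<^sup>2 + real s) powr (- 1 / 2)"
  have "a\<^sup>2 + real s > 0" using assms by (intro add_pos_nonneg) auto
  then have c: "c > 0" by (simp add: c_def)
  have p: "(\<Sum>i=1..n. v a s i ^ k) = c ^ k * (a ^ k + real s)" if "k > 0" for k
    unfolding c_def using that assms(2) by (rule v_power_sum)
  have N: "real n - 1 > 0" using assms by simp
  define P Q where "P = a\<^sup>2 + real s" and "Q = a ^ 4 + real s"
  have e: "(c\<^sup>2 * P)\<^sup>2 = c ^ 4 * P\<^sup>2"
    by (simp add: power_mult_distrib)
  have "f4 n (v a s) = c ^ 4 * Q - 3 / (real n - 1) * ((c\<^sup>2 * P)\<^sup>2 - c ^ 4 * Q)"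
    unfolding f4_power_sums by (simp add: p P_def Q_def del: One_nat_def)
  then have "(real n - 1) * f4 n (v a s) = c ^ 4 * ?F"
    unfolding e P_def[symmetric] Q_def[symmetric] using N by (simp add: field_simps)
  then show ?thesis using c N
    by (metis mult_eq_0_iff power_eq_0_iff less_irrefl)
qed

text \<open>Again by homogeneity, now of degree 6; \<open>n \<ge> 3\<close> makes both denominators
  positive.\<close>

lemma f6_v_eq_0_iff:
  assumes "n \<ge> 3" "s < n" "a > 0"
  shows "f6 n (v a s) = 0 \<longleftrightarrow>
    (real n - 1) * (real n - 2) * (a ^ 6 + real s)
    - 15 * (real n - 2) * ((a\<^sup>2 + real s) * (a ^ 4 + real s) - (a ^ 6 + real s))
    + 30 * ((a\<^sup>2 + real s) ^ 3 - 3 * (a\<^sup>2 + real s) * (a ^ 4 + real s) + 2 * (a ^ 6 + real s)) = 0"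
    (is "_ \<longleftrightarrow> ?F = 0")
proof -
  define c where "c = (a\<^sup>2 + real s) powr (- 1 / 2)"
  have "a\<^sup>2 + real s > 0" using assms by (intro add_pos_nonneg) auto
  then have c: "c > 0" by (simp add: c_def)
  have p: "(\<Sum>i=1..n. v a s i ^ k) = c ^ k * (a ^ k + real s)" if "k > 0" for k
    unfolding c_def using that assms(2) by (rule v_power_sum)
  define M K where "M = real n - 1" and "K = real n - 2"
  have MK: "M > 0" "K > 0" using assms by (simp_all add: M_def K_def)
  define P Q R where "P = a ^ 2 + real s" and "Q = a ^ 4 + real s" and "R = a ^ 6 + real s"
  have e: "(c ^ 2 * P) ^ 3 = c ^ 6 * P ^ 3" "c ^ 2 * P * (c ^ 4 * Q) = c ^ 6 * (P * Q)"
    by (simp_all add: eval_nat_numeral)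
  have f6: "f6 n (v a s) = c ^ 6 * R - 15 / M * (c ^ 2 * P * (c ^ 4 * Q) - c ^ 6 * R)
    + 30 / (M * K) * ((c ^ 2 * P) ^ 3 - 3 * (c ^ 2 * P * (c ^ 4 * Q)) + 2 * (c ^ 6 * R))"
    unfolding f6_power_sums by (simp add: p P_def Q_def R_def M_def K_def del: One_nat_def)
  have "M * K * f6 n (v a s) = c ^ 6 * ?F"
    unfolding f6 e P_def[symmetric] Q_def[symmetric] R_def[symmetric] M_def[symmetric] K_def[symmetric]
    using MK by (simp add: field_simps)
  then show ?thesis using c MK
    by (metis mult_eq_0_iff power_eq_0_iff less_irrefl)
qed

section \<open>Elimination of \<open>t\<close> and uniqueness of the root\<close>

text \<open>Up to a factor in \<open>N\<close> and \<open>s\<close>, the resultant with respect to \<open>t\<close> of the two equations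
  in \<open>common_root_imp_quartic_eq_0\<close>.\<close>

definition quartic :: "real \<Rightarrow> real \<Rightarrow> real" where
  "quartic N s = - 9 * (3 * N + 5) * s ^ 4 + 27 * N * (N + 3) * s ^ 3
     - 3 * (3 * N ^ 3 + 10 * N\<^sup>2 - 10 * N - 15) * s\<^sup>2
     + N * (N + 3) * (N\<^sup>2 - 2 * N - 26) * s + N\<^sup>2 * (N + 5)\<^sup>2"

lemma common_root_imp_quartic_eq_0:
  fixes N s t :: real
  assumes "N > 0" "s \<noteq> 0"
    and f4: "N * (t ^ 2 + s) - 3 * ((t + s)\<^sup>2 - (t ^ 2 + s)) = 0"
    and f6: "N * (N - 1) * (t ^ 3 + s) - 15 * (N - 1) * ((t + s) * (t ^ 2 + s) - (t ^ 3 + s))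
      + 30 * ((t + s) ^ 3 - 3 * (t + s) * (t ^ 2 + s) + 2 * (t ^ 3 + s)) = 0"
  shows "quartic N s = 0"
proof -
  define \<alpha> \<beta> where "\<alpha> = 3 * s * (N + 2) - N * (N + 8)"
    and "\<beta> = 3 * s\<^sup>2 - 3 * (2 * N + 1) * s + N * (N + 5)"
  define D where "D = N * s - 3 * s * (s - 1)"
  define A where "A = N * t\<^sup>2 - 6 * s * t + D"
  define B where "B = N * (N - 1) * (t ^ 3 + s)
    - 15 * (N - 1) * ((t + s) * (t ^ 2 + s) - (t ^ 3 + s))
    + 30 * ((t + s) ^ 3 - 3 * (t + s) * (t ^ 2 + s) + 2 * (t ^ 3 + s))"
  have A: "A = 0"
    using f4 by (simp add: A_def D_def algebra_simps power2_eq_square)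
  \<comment> \<open>Division of \<open>N * B\<close> by \<open>A\<close> as polynomials in
    \<open>t\<close>; the factor \<open>N\<close>, the leading coefficient of \<open>A\<close>,
    keeps the quotient polynomial. The linear remainder must vanish, and its factor
    \<open>s * (N + 9)\<close> is nonzero.\<close>
  have "N * B = A * ((N - 1) * (N * t - 9 * s)) + s * (N + 9) * (\<alpha> * t + \<beta>)"
    unfolding A_def B_def D_def \<alpha>_def \<beta>_def
    by (simp add: algebra_simps power2_eq_square power3_eq_cube)
  moreover have "B = 0" using f6 by (simp add: B_def)
  ultimately have t: "\<alpha> * t = - \<beta>" using A assms(1,2) by simp
  \<comment> \<open>\<open>\<alpha>\<close> may be zero, so instead of solving for \<open>t\<close>
    one multiplies \<open>A\<close> by \<open>\<alpha>\<^sup>2\<close> and substitutes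
    \<open>- \<beta>\<close> for \<open>\<alpha> * t\<close>.\<close>
  have "N * quartic N s = N * \<beta>\<^sup>2 + 6 * s * \<alpha> * \<beta> + D * \<alpha>\<^sup>2"
    unfolding quartic_def \<alpha>_def \<beta>_def D_def
    by (simp add: algebra_simps power2_eq_square power3_eq_cube power4_eq_xxxx)
  also have "\<dots> = N * (\<alpha> * t)\<^sup>2 - 6 * s * \<alpha> * (\<alpha> * t) + D * \<alpha>\<^sup>2"
    unfolding t by simp
  also have "\<dots> = \<alpha>\<^sup>2 * A"
    by (simp add: A_def algebra_simps power2_eq_square)
  finally show ?thesis using A assms by simp
qed

text \<open>The expression is \<open>- s ^ 5\<close> times the derivative of
  \<open>quartic N s / s ^ 4\<close> in \<open>s\<close>; the leading coefficient of the quartic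
  drops out.\<close>

lemma quartic_slope_pos:
  fixes N s :: real
  assumes "N \<ge> 2" "s \<ge> 1"
  shows "27 * N * (N + 3) * s ^ 3 - 6 * (3 * N ^ 3 + 10 * N\<^sup>2 - 10 * N - 15) * s\<^sup>2
     + 3 * N * (N + 3) * (N\<^sup>2 - 2 * N - 26) * s + 4 * N\<^sup>2 * (N + 5)\<^sup>2 > 0" (is "?C > 0")
proof -
  \<comment> \<open>For large \<open>N\<close> the left-hand side is \<open>27 N\<^sup>2 s (s - N / 3)\<^sup>2\<close> to leading order, so it has an
    almost double root near \<open>N / 3\<close>; completing the square at \<open>m\<close> leaves a linear
    remainder that is positive for \<open>s \<ge> 1\<close>.\<close>
  define m where "m = (N + 2) / 3"
  define e where "e = 2 * N ^ 3 + 8 * N\<^sup>2 + 14 * N + 120"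
  define f where "f = (2 * N ^ 4 + 24 * N ^ 3 + 6 * N\<^sup>2 - 344 * N - 120) / 3"
  have C: "?C = (27 * N * (N + 3) * s + (30 * N\<^sup>2 + 168 * N + 90)) * (s - m)\<^sup>2
      + e * (s - 1) + (e + f)"
    unfolding m_def e_def f_def
    by (simp add: field_simps power2_eq_square power3_eq_cube power4_eq_xxxx)
  have "e \<ge> 0" using assms by (simp add: e_def)
  moreover have "e + f > 0"
  proof -
    \<comment> \<open>Expanded around the smallest admissible \<open>N\<close>, the polynomial has
      only positive coefficients.\<close>
    define k where "k = N - 2"
    have "3 * (e + f) = 2 * k ^ 4 + 46 * k ^ 3 + 258 * k\<^sup>2 + 242 * k + 28"
      unfolding e_def f_def k_def
      by (simp add: field_simps power2_eq_square power3_eq_cube power4_eq_xxxx)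
    moreover have "k \<ge> 0" using assms by (simp add: k_def)
    ultimately show ?thesis by (smt (verit) mult_nonneg_nonneg zero_le_power)
  qed
  moreover have "(27 * N * (N + 3) * s + (30 * N\<^sup>2 + 168 * N + 90)) * (s - m)\<^sup>2 \<ge> 0"
    using assms by (intro mult_nonneg_nonneg add_nonneg_nonneg) auto
  ultimately show ?thesis unfolding C using assms
    by (smt (verit) mult_nonneg_nonneg)
qed

lemma quartic_root_unique:
  fixes N :: real
  assumes N: "N \<ge> 2" and "s1 \<ge> 1" "s2 \<ge> 1" and roots: "quartic N s1 = 0" "quartic N s2 = 0"
  shows "s1 = s2"
proof -
  have decreasing: "quartic N y / y ^ 4 < quartic N x / x ^ 4" if "1 \<le> x" "x < y" for x y
  proof (rule DERIV_neg_imp_decreasing[OF \<open>x < y\<close>])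
    fix s assume "x \<le> s" "s \<le> y"
    then have s: "s \<ge> 1" using that by simp
    let ?C = "27 * N * (N + 3) * s ^ 3 - 6 * (3 * N ^ 3 + 10 * N\<^sup>2 - 10 * N - 15) * s\<^sup>2
     + 3 * N * (N + 3) * (N\<^sup>2 - 2 * N - 26) * s + 4 * N\<^sup>2 * (N + 5)\<^sup>2"
    have "((\<lambda>s. quartic N s / s ^ 4) has_real_derivative - ?C / s ^ 5) (at s)"
      unfolding quartic_def using s
      by (auto intro!: derivative_eq_intros simp: divide_simps) (simp add: eval_nat_numeral algebra_simps)
    moreover have "- ?C / s ^ 5 < 0"
      using quartic_slope_pos[OF N s] s by (simp add: divide_neg_pos)
    ultimately show "\<exists>d. ((\<lambda>s. quartic N s / s ^ 4) has_real_derivative d) (at s) \<and> d < 0"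
      by blast
  qed
  show ?thesis
    using decreasing[of s1 s2] decreasing[of s2 s1] assms by (cases s1 s2 rule: linorder_cases) auto
qed

section \<open>Application to the vectors \<open>v a s\<close>\<close>

text \<open>The elimination with \<open>N = n - 1\<close> and \<open>t = a\<^sup>2\<close>. For the
  natural number \<open>s\<close>, being nonzero gives \<open>s \<ge> 1\<close>, the range in which
  the root is unique.\<close>

lemma quartic_root_if_f4_f6_v_eq_0:
  assumes "n \<ge> 3" "s < n" "a > 0" "f4 n (v a s) = 0" "f6 n (v a s) = 0"
  shows "s \<noteq> 0" "quartic (real n - 1) (real s) = 0"
proof -
  have f4: "(real n - 1) * (a ^ 4 + real s) - 3 * ((a\<^sup>2 + real s)\<^sup>2 - (a ^ 4 + real s)) = 0"
    using assms f4_v_eq_0_iff by blast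
  show "s \<noteq> 0"
    \<comment> \<open>At \<open>s = 0\<close> the subtracted bracket cancels, leaving
      \<open>(n - 1) * a ^ 4\<close>, which is positive.\<close>
    using f4 assms by (intro notI) (simp flip: power_mult)
  have a: "a ^ 4 = (a\<^sup>2)\<^sup>2" "a ^ 6 = (a\<^sup>2) ^ 3" by (simp_all flip: power_mult)
  show "quartic (real n - 1) (real s) = 0"
  proof (rule common_root_imp_quartic_eq_0)
    show "(real n - 1) * ((a\<^sup>2)\<^sup>2 + real s) - 3 * ((a\<^sup>2 + real s)\<^sup>2 - ((a\<^sup>2)\<^sup>2 + real s)) = 0"
      using f4 unfolding a .
    have *: "real n - 1 - 1 = real n - 2" by simp
    show "(real n - 1) * (real n - 1 - 1) * ((a\<^sup>2) ^ 3 + real s)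
      - 15 * (real n - 1 - 1) * ((a\<^sup>2 + real s) * ((a\<^sup>2)\<^sup>2 + real s) - ((a\<^sup>2) ^ 3 + real s))
      + 30 * ((a\<^sup>2 + real s) ^ 3 - 3 * (a\<^sup>2 + real s) * ((a\<^sup>2)\<^sup>2 + real s)
      + 2 * ((a\<^sup>2) ^ 3 + real s)) = 0"
      using f6_v_eq_0_iff[OF assms(1-3)] assms(5) unfolding a * by blast
  qed (use assms \<open>s \<noteq> 0\<close> in auto)
qed

theorem theorem5p3:
  fixes n s1 s2 :: nat and a1 a2 :: real
  assumes "n \<ge> 3"
    and "a1 > 0" and "a2 > 0"
    and "s1 \<in> {0..n - 1}" and "s2 \<in> {0..n - 1}" and "s1 \<noteq> s2"
  shows "\<not> (f4 n (v a1 s1) = 0 \<and> f4 n (v a2 s2) = 0 \<and>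
            f6 n (v a1 s1) = 0 \<and> f6 n (v a2 s2) = 0)"
proof
  assume zero: "f4 n (v a1 s1) = 0 \<and> f4 n (v a2 s2) = 0 \<and>
            f6 n (v a1 s1) = 0 \<and> f6 n (v a2 s2) = 0"
  have s: "s1 < n" "s2 < n" using assms by auto
  have "real s1 = real s2"
  proof (rule quartic_root_unique)
    show "real n - 1 \<ge> 2" using assms by simp
    show "quartic (real n - 1) (real s1) = 0" "quartic (real n - 1) (real s2) = 0"
      using quartic_root_if_f4_f6_v_eq_0(2) assms s zero by blast+
    show "real s1 \<ge> 1" "real s2 \<ge> 1"
      using quartic_root_if_f4_f6_v_eq_0(1) assms s zero
      by (metis One_nat_def Suc_leI gr0I of_nat_1 of_nat_le_iff)+
  qed
  with assms show False by simp
qed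

end
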